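(* In the quaternion algebra $H$ over $\mathbb{R}$ there exists a quadratic equation which has no root in $H$.
   Context: A quadratic equation over $H$ is an equation in the unknown $x\in H$ of the form $$(a_{s\cdot 0}\otimes a_{s\cdot 1}\otimes a_{s\cdot 2})\circ x^2+(b_{t\cdot 0}\otimes b_{t\cdot 1})\circ x+c=0,$$ that is, $$\sum_s a_{s\cdot 0}\,x\,a_{s\cdot 1}\,x\,a_{s\cdot 2}+\sum_t b_{t\cdot 0}\,x\,b_{t\cdot 1}+c=0,$$ with finite sums, all coefficients $a_{s\cdot 0},a_{s\cdot 1},a_{s\cdot 2},b_{t\cdot 0},b_{t\cdot 1},c$ in $H$, and the quadratic part $\sum_s a_{s\cdot 0}xa_{s\cdot 1}xa_{s\cdot 2}$ not identically zero. $H$ is the usual algebra of real quaternions. *)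

theory Defs
  imports Complex_Main
begin

section \<open>The real algebra of quaternions\<close>

text \<open>\<open>Quat a b c d\<close> stands for the quaternion $a + bi + cj + dk$.\<close>

datatype quat = Quat (qRe: real) (qI: real) (qJ: real) (qK: real)

lemma quat_eq_iff:
  "x = y \<longleftrightarrow> qRe x = qRe y \<and> qI x = qI y \<and> qJ x = qJ y \<and> qK x = qK y"
  by (cases x; cases y) simp

instantiation quat :: real_algebra_1
begin

definition "0 = Quat 0 0 0 0"

definition "1 = Quat 1 0 0 0"

definition "x + y = Quat (qRe x + qRe y) (qI x + qI y) (qJ x + qJ y) (qK x + qK y)"

definition "- x = Quat (- qRe x) (- qI x) (- qJ x) (- qK x)"

definition "x - y = Quat (qRe x - qRe y) (qI x - qI y) (qJ x - qJ y) (qK x - qK y)"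

definition "r *\<^sub>R x = Quat (r * qRe x) (r * qI x) (r * qJ x) (r * qK x)"

definition "x * y = Quat
  (qRe x * qRe y - qI x * qI y - qJ x * qJ y - qK x * qK y)
  (qRe x * qI y + qI x * qRe y + qJ x * qK y - qK x * qJ y)
  (qRe x * qJ y - qI x * qK y + qJ x * qRe y + qK x * qI y)
  (qRe x * qK y + qI x * qJ y - qJ x * qI y + qK x * qRe y)"

instance
  by standard
    (simp_all add: quat_eq_iff zero_quat_def one_quat_def plus_quat_def uminus_quat_def
      minus_quat_def scaleR_quat_def times_quat_def algebra_simps)

end

definition quat_i :: quat where "quat_i = Quat 0 1 0 0"
definition quat_j :: quat where "quat_j = Quat 0 0 1 0"
definition quat_k :: quat where "quat_k = Quat 0 0 0 1"

lemma quat_basis_mult: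
  "quat_i * quat_i = - 1" "quat_j * quat_j = - 1" "quat_k * quat_k = - 1"
  "quat_i * quat_j = quat_k" "quat_j * quat_k = quat_i" "quat_k * quat_i = quat_j"
  "quat_j * quat_i = - quat_k" "quat_k * quat_j = - quat_i" "quat_i * quat_k = - quat_j"
  by (simp_all add: quat_i_def quat_j_def quat_k_def times_quat_def uminus_quat_def one_quat_def)

lemma Quat_conv_basis:
  "Quat a b c d = of_real a + b *\<^sub>R quat_i + c *\<^sub>R quat_j + d *\<^sub>R quat_k"
  by (simp add: of_real_def quat_i_def quat_j_def quat_k_def scaleR_quat_def plus_quat_def
      one_quat_def)

section \<open>Quadratic equations\<close>

text \<open>
  A tensor in $H \otimes H \otimes H$ (respectively $H \otimes H$) is represented by the finite
  list of the elementary tensors of which it is the sum; \<open>quad_part\<close> and \<open>lin_part\<close> are its action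
  on $x^2$ (respectively on $x$), in which the unknown fills the gaps between the tensor factors.
\<close>

definition quad_part :: "(quat \<times> quat \<times> quat) list \<Rightarrow> quat \<Rightarrow> quat" where
  "quad_part A x = (\<Sum>(a0, a1, a2)\<leftarrow>A. a0 * x * a1 * x * a2)"

definition lin_part :: "(quat \<times> quat) list \<Rightarrow> quat \<Rightarrow> quat" where
  "lin_part B x = (\<Sum>(b0, b1)\<leftarrow>B. b0 * x * b1)"

text \<open>The data \<open>A\<close>, \<open>B\<close>, \<open>c\<close> encode the equation \<open>quad_part A x + lin_part B x + c = 0\<close>.\<close>

definition quadratic_equation ::
  "(quat \<times> quat \<times> quat) list \<Rightarrow> (quat \<times> quat) list \<Rightarrow> quat \<Rightarrow> bool" where
  "quadratic_equation A B c \<longleftrightarrow> (\<exists>x. quad_part A x \<noteq> 0)"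

definition is_root ::
  "(quat \<times> quat \<times> quat) list \<Rightarrow> (quat \<times> quat) list \<Rightarrow> quat \<Rightarrow> quat \<Rightarrow> bool" where
  "is_root A B c x \<longleftrightarrow> quad_part A x + lin_part B x + c = 0"

end

theory Submission
  imports Defs
begin

text \<open>
  The real part is a trace on $H$: it does not distinguish $xy$ from $yx$, so every commutator
  has real part $0$ and the equation $ay - ya + 1 = 0$ has no solution $y$, whatever $a$ is.
  Substituting $y = x^2$ makes it quadratic in $x$. For $a = i$ the quadratic part
  $ix^2 - x^2i$ does not vanish identically, because $i$ is not central and squares reach
  outside the subalgebra of elements commuting with $i$; for instance $(1 + j)^2 = 2j$.
\<close>

lemma qRe_mult_commute: "qRe (x * y) = qRe (y * x)"
  by (simp add: times_quat_def algebra_simps)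

lemma commutator_plus_one_nonzero: "x * y - y * x + 1 \<noteq> (0 :: quat)"
proof
  assume "x * y - y * x + 1 = 0"
  then have "qRe (x * y - y * x + 1) = qRe 0"
    by simp
  then show False
    using qRe_mult_commute[of x y]
    by (simp add: plus_quat_def minus_quat_def zero_quat_def one_quat_def)
qed

theorem theorem7p3:
  shows "\<exists>A B c. quadratic_equation A B c \<and> \<not> (\<exists>x. is_root A B c x)"
proof -
  define A :: "(quat \<times> quat \<times> quat) list"
    where "A = [(quat_i, 1, 1), (- 1, 1, quat_i)]"
  have quad: "quad_part A x = quat_i * (x * x) - (x * x) * quat_i" for x
    by (simp add: A_def quad_part_def mult.assoc)
  have "quad_part A (1 + quat_j) \<noteq> 0"
    unfolding quad
    by (simp add: quat_i_def quat_j_def plus_quat_def minus_quat_def times_quat_def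
        one_quat_def zero_quat_def)
  then have "quadratic_equation A [] 1"
    unfolding quadratic_equation_def by blast
  moreover have "\<not> (\<exists>x. is_root A [] 1 x)"
    using commutator_plus_one_nonzero by (simp add: is_root_def lin_part_def quad)
  ultimately show ?thesis
    by blast
qed

end
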